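(* Let $p$ be a prime, let $e\geq 1$ be an integer, and let $q=p^{e}$. Let $A\subseteq\mathbb{F}_{q}^{2}$ with $1<|A|\leq q$, and let $D$ be the set of directions determined by $A$. Then at least one of the following holds: (i) $|D|=1$ (and $A$ is contained in a line); (ii) $|D|=q+1$ (and $A$ spans all directions); (iii) there are two integers $0\leq l_{2}\leq l_{1}<e$ such that $$|D|\geq\frac{|A|-1}{p^{l_{2}}+1}+2$$ and $$|D|\leq q-|A|+\max\left\{1,\ \frac{|A|-1-(q-|A|)\max\{0,\ |A|+p^{l_{1}}-q-1\}}{p^{l_{1}}-1}\right\},$$ where, if $l_{1}=0$, the upper bound is considered trivial (i.e. no upper bound is asserted).
   Context: $\mathbb{F}_q$ denotes the finite field with $q$ elements. For a set $A\subseteq\mathbb{F}_q^{2}$, the set of directions spanned (or determined) by $A$ is $$D=\left\{\frac{b'-b}{a'-a}\ :\ (a,b),(a',b')\in A,\ (a,b)\neq(a',b')\right\}\subseteq\mathbb{F}_q\cup\{\infty\},$$ where by convention the fraction equals $\infty$ when $a'-a=0$. Lines are affine lines in $\mathbb{F}_q^2$. *)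

theory Defs
  imports Complex_Main "HOL-Computational_Algebra.Primes"
begin

text \<open>Elements of \<open>F \<union> {\<infinity>}\<close> are encoded as \<^typ>\<open>'a option\<close>, where \<^const>\<open>None\<close>
  stands for \<open>\<infinity>\<close>.\<close>

definition direction :: "'a::field \<times> 'a \<Rightarrow> 'a \<times> 'a \<Rightarrow> 'a option" where
  "direction P Q =
     (if fst Q - fst P = 0 then None else Some ((snd Q - snd P) / (fst Q - fst P)))"

definition directions :: "('a::field \<times> 'a) set \<Rightarrow> 'a option set" where
  "directions A = {direction P Q | P Q. P \<in> A \<and> Q \<in> A \<and> P \<noteq> Q}"

definition affine_line :: "('a::field \<times> 'a) set \<Rightarrow> bool" where
  "affine_line L \<longleftrightarrow>
     (\<exists>a b c. (a, b) \<noteq> (0, 0) \<and> L = {(x, y). a * x + b * y = c})"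

end

theory Submission
  imports Defs "HOL-Computational_Algebra.Polynomial"
begin

text \<open>
  For a direction \<open>d\<close> let \<open>R\<^sub>d\<close> be the product of \<open>X - r\<close> over the intercepts \<open>r\<close> of the lines of
  direction \<open>d\<close> through the points of \<open>A\<close>, let \<open>F\<^sub>d\<close> be the quotient of \<open>X^q\<close> by \<open>R\<^sub>d\<close>, and let
  \<open>H\<^sub>d = R\<^sub>d F\<^sub>d\<close>. The coefficients of these polynomials are binary forms in \<open>d\<close>, the \<open>i\<close>-th one
  from the top having degree \<open>i\<close>. Since \<open>H\<^sub>d = X^q - X\<close> for all \<open>q + 1 - |D|\<close> directions outside \<open>D\<close>,
  the forms of smaller degree vanish identically, so \<open>H\<^sub>d - X^q\<close> has degree less than \<open>|D|\<close> for
  every \<open>d\<close>. Take \<open>l\<close> maximal such that \<open>H\<^sub>d\<close> is a \<open>p^l\<close>-th power for all \<open>d\<close> in \<open>D\<close>; then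
  \<open>l1 = l2 = l\<close> works. For the lower bound, choose \<open>d\<close> with \<open>H\<^sub>d = K^(p^l)\<close> and \<open>K' \<noteq> 0\<close> and
  count the roots of \<open>R\<^sub>d\<close>. For the upper bound, count the points of \<open>A\<close> on the lines through
  a fixed point of \<open>A\<close>: roots of \<open>H\<^sub>d\<close> have multiplicity divisible by \<open>p^l\<close>, and the value of \<open>F\<^sub>d\<close> at
  the fixed point is a nonzero form of degree \<open>q - |A|\<close>, so it rarely vanishes.
\<close>

section \<open>Polynomials in characteristic p\<close>

text \<open>Translation by 1 permutes the ring, so adding 1 to every summand leaves the sum of all
  elements unchanged.\<close>

lemma CHAR_dvd_card_UNIV: "CHAR('a::{ring_1, finite}) dvd card (UNIV :: 'a set)"
proof -
  have "(\<Sum>x\<in>UNIV. x + 1) = (\<Sum>x\<in>UNIV. x :: 'a)"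
    by (rule sum.reindex_bij_witness[of _ "\<lambda>x. x - 1" "\<lambda>x. x + 1"]) auto
  then have "of_nat (card (UNIV :: 'a set)) = (0 :: 'a)"
    by (simp add: sum.distrib)
  then show ?thesis by (simp add: of_nat_eq_0_iff_char_dvd)
qed

lemma order_linear: "order r [:- s, 1:] = (if r = s then 1 else 0)" for r s :: "'a::field"
proof (cases "r = s")
  case True
  then show ?thesis using order_power_n_n[of s 1] by simp
next
  case False
  then show ?thesis by (auto intro!: order_0I)
qed

lemma order_prod_linear:
  fixes f :: "'b \<Rightarrow> 'a::field"
  assumes "finite S"
  shows "order r (\<Prod>x\<in>S. [:- f x, 1:]) = card {x \<in> S. f x = r}"
  using assms
proof (induction S)
  case empty
  then show ?case by simp
next
  case (insert a S)
  have nz: "(\<Prod>x\<in>S. [:- f x, 1:]) \<noteq> 0"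
    using insert.hyps by simp
  have "{x \<in> insert a S. f x = r} =
      (if r = f a then insert a {x \<in> S. f x = r} else {x \<in> S. f x = r})"
    by auto
  then show ?case
    using insert nz by (simp add: order_mult order_linear del: mult_pCons_left)
qed

lemma order_power: "p \<noteq> 0 \<Longrightarrow> order r (p ^ n) = n * order r p" for p :: "'a::field poly"
  by (induction n) (auto simp: order_mult)

text \<open>A root of order n + 1 leaves a factor of order n in the derivative. In positive
  characteristic the order there can be larger, so only an inequality holds.\<close>

lemma order_le_Suc_order_pderiv:
  fixes p :: "'a::field poly"
  assumes "pderiv p \<noteq> 0"
  shows "order z p \<le> Suc (order z (pderiv p))"
proof (cases "order z p")
  case (Suc n)
  then obtain q where "p = [:- z, 1:] ^ Suc n * q"
    using order_1[of z p] by (auto elim: dvdE)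
  then have "pderiv p = [:- z, 1:] ^ n * ([:- z, 1:] * pderiv q + smult (of_nat (Suc n)) q)"
    by (simp only: lemma_order_pderiv1) (simp add: algebra_simps)
  then have "[:- z, 1:] ^ n dvd pderiv p"
    by (metis dvd_triv_left)
  then show ?thesis
    using assms Suc order_divides[of z n "pderiv p"] by simp
qed simp

lemma sum_order_le_degree':
  fixes p :: "'a::{field, finite} poly"
  assumes "p \<noteq> 0"
  shows "(\<Sum>z\<in>Z. order z p) \<le> degree p"
proof -
  have "(\<Sum>z\<in>Z. order z p) \<le> (\<Sum>z\<in>UNIV. order z p)"
    by (rule sum_mono2) auto
  also have "\<dots> = (\<Sum>z | poly p z = 0. order z p)"
    by (rule sum.mono_neutral_right) (auto simp: order_root)
  also have "\<dots> \<le> degree p"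
    by (rule sum_order_le_degree[OF assms])
  finally show ?thesis .
qed

text \<open>Iterated Frobenius is additive, hence acts on each monomial separately.\<close>

lemma power_CHAR_power_eq_sum:
  fixes p :: "'a::field_prime_char poly"
  shows "p ^ (CHAR('a) ^ l) =
    (\<Sum>i\<le>degree p. monom (coeff p i ^ (CHAR('a) ^ l)) (CHAR('a) ^ l * i))"
proof -
  have "p ^ (CHAR('a) ^ l) = (\<Sum>i\<le>degree p. monom (coeff p i) i) ^ (CHAR('a) ^ l)"
    by (simp add: poly_as_sum_of_monoms)
  also have "\<dots> = (\<Sum>i\<le>degree p. monom (coeff p i) i ^ (CHAR('a) ^ l))"
    by (rule freshmans_dream_sum'[of "CHAR('a) ^ l" l]) auto
  finally show ?thesis by (simp add: monom_power mult.commute)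
qed

lemma coeff_power_CHAR_power:
  fixes p :: "'a::field_prime_char poly"
  shows "coeff (p ^ (CHAR('a) ^ l)) (CHAR('a) ^ l * j) = coeff p j ^ (CHAR('a) ^ l)"
proof -
  have "coeff (p ^ (CHAR('a) ^ l)) (CHAR('a) ^ l * j) =
      (\<Sum>i\<le>degree p. if i = j then coeff p i ^ (CHAR('a) ^ l) else 0)"
    by (simp add: power_CHAR_power_eq_sum[of p l] coeff_sum)
  also have "\<dots> = (if j \<le> degree p then coeff p j ^ (CHAR('a) ^ l) else 0)"
    by simp
  also have "\<dots> = coeff p j ^ (CHAR('a) ^ l)"
    by (auto simp: coeff_eq_0)
  finally show ?thesis .
qed

text \<open>A zero derivative leaves only exponents divisible by the characteristic, and over a
  finite field every coefficient is itself a power of that exponent.\<close>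

lemma pderiv_eq_0_imp_CHAR_power:
  fixes p :: "'a::finite_field poly"
  assumes "pderiv p = 0" and card: "card (UNIV :: 'a set) = CHAR('a) ^ e"
  shows "\<exists>r. p = r ^ CHAR('a)"
proof -
  let ?c = "CHAR('a)"
  have "e \<noteq> 0"
  proof
    assume "e = 0"
    then have "card (UNIV :: 'a set) = 1" using card by simp
    then have "(0 :: 'a) = 1" by (metis (full_types) UNIV_I card_1_singletonE singletonD)
    then show False by simp
  qed
  then obtain k where e: "e = Suc k" by (cases e) auto
  \<comment> \<open>Since \<open>x ^ q = x\<close> with q the (k + 1)-st power of \<open>?c\<close>,
    k applications of Frobenius invert it.\<close>
  have root: "(x ^ (?c ^ k)) ^ ?c = x" for x :: 'a
    using finite_field_power_card_eq_same[of x] card e by (simp add: power_mult [symmetric] mult.commute)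
  have supp: "coeff p i = 0" if "\<not> ?c dvd i" for i
  proof -
    have "i \<noteq> 0" using that by (auto intro: ccontr)
    then obtain j where j: "i = Suc j" by (cases i) auto
    have "of_nat i * coeff p i = 0"
      using coeff_pderiv[of p j] assms(1) j by simp
    then show ?thesis using that by (simp add: of_nat_eq_0_iff_char_dvd del: of_nat_Suc)
  qed
  define r where "r = (\<Sum>i\<le>degree p. monom (coeff p (?c * i) ^ (?c ^ k)) i)"
  have "r ^ ?c = (\<Sum>i\<le>degree p. monom (coeff p (?c * i) ^ (?c ^ k)) i ^ ?c)"
    unfolding r_def by (rule freshmans_dream_sum) auto
  also have "\<dots> = (\<Sum>i\<le>degree p. monom (coeff p (?c * i)) (?c * i))"
    by (simp add: monom_power root mult.commute)
  also have "\<dots> = p"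
  proof (rule poly_eqI)
    fix m
    show "coeff (\<Sum>i\<le>degree p. monom (coeff p (?c * i)) (?c * i)) m = coeff p m"
    proof (cases "?c dvd m")
      case True
      then obtain j where m: "m = ?c * j" by auto
      have "1 * j \<le> ?c * j" by (intro mult_right_mono) (simp_all add: Suc_le_eq)
      then have "j \<le> m" using m by simp
      then have out: "coeff p m = 0" if "\<not> j \<le> degree p"
        using that by (intro coeff_eq_0) linarith
      have "coeff (\<Sum>i\<le>degree p. monom (coeff p (?c * i)) (?c * i)) m =
          (\<Sum>i\<le>degree p. if i = j then coeff p (?c * i) else 0)"
        by (simp add: coeff_sum m)
      also have "\<dots> = coeff p m"
        using out m by auto
      finally show ?thesis .
    next
      case False
      then have "coeff (\<Sum>i\<le>degree p. monom (coeff p (?c * i)) (?c * i)) m = 0"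
        by (auto simp: coeff_sum intro!: sum.neutral)
      then show ?thesis using supp[OF False] by simp
    qed
  qed
  finally show ?thesis by metis
qed

text \<open>Both sides are monic of degree q and vanish on the whole field, so their difference has
  degree below q but q roots.\<close>

lemma prod_UNIV_linear:
  "(\<Prod>x\<in>UNIV. [:- x, 1:]) = monom 1 (card (UNIV :: 'a set)) - monom (1 :: 'a::finite_field) 1"
proof (rule ccontr)
  let ?q = "card (UNIV :: 'a set)"
  let ?P = "\<Prod>x\<in>UNIV. [:- x :: 'a, 1:]" and ?Q = "monom 1 ?q - monom (1 :: 'a) 1"
  assume "?P \<noteq> ?Q"
  then have nz: "?P - ?Q \<noteq> 0" by simp
  have "card {0, 1 :: 'a} \<le> ?q" by (rule card_mono) auto
  then have q: "1 < ?q" by simp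
  have degP: "degree ?P = ?q" by (subst degree_prod_eq_sum_degree) auto
  have lcP: "coeff ?P ?q = 1"
    using lead_coeff_prod[of "\<lambda>x. [:- x :: 'a, 1:]" UNIV] degP by simp
  have "degree (?P - ?Q) \<le> ?q"
    using degP q by (intro degree_diff_le) (auto intro: degree_monom_le le_trans)
  moreover have "coeff (?P - ?Q) ?q = 0"
    using lcP q by simp
  ultimately have "degree (?P - ?Q) < ?q"
    using nz by (metis le_neq_implies_less leading_coeff_0_iff)
  moreover have "poly ?P x = 0" for x
    unfolding poly_prod by (rule prod_zero) auto
  then have "{x. poly (?P - ?Q) x = 0} = UNIV"
    by (auto simp: poly_monom finite_field_power_card_eq_same)
  ultimately show False
    using card_poly_roots_bound[OF nz] by simp
qed

section \<open>Forms on the line at infinity\<close>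

text \<open>
  \<open>direction_form k \<phi>\<close> says that \<open>\<phi>\<close> is a binary form of degree \<open>k\<close>, evaluated at the
  representative \<open>(m, 1)\<close> of the direction \<open>Some m\<close> and \<open>(1, 0)\<close> of \<open>None\<close>.
\<close>

definition direction_form :: "nat \<Rightarrow> ('a::field option \<Rightarrow> 'a) \<Rightarrow> bool" where
  "direction_form k \<phi> \<longleftrightarrow>
     (\<exists>p. degree p \<le> k \<and> (\<forall>m. \<phi> (Some m) = poly p m) \<and> \<phi> None = coeff p k)"

lemma direction_form_const: "direction_form 0 (\<lambda>_. c)"
  unfolding direction_form_def by (rule exI[of _ "[:c:]"]) simp

lemma direction_form_zero: "direction_form k (\<lambda>_. 0)"
  unfolding direction_form_def by (rule exI[of _ 0]) simp

lemma direction_form_add: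
  assumes "direction_form k \<phi>" "direction_form k \<psi>"
  shows "direction_form k (\<lambda>d. \<phi> d + \<psi> d)"
proof -
  obtain p q where "degree p \<le> k" "\<forall>m. \<phi> (Some m) = poly p m" "\<phi> None = coeff p k"
    "degree q \<le> k" "\<forall>m. \<psi> (Some m) = poly q m" "\<psi> None = coeff q k"
    using assms unfolding direction_form_def by blast
  then show ?thesis
    unfolding direction_form_def by (intro exI[of _ "p + q"]) (simp add: degree_add_le)
qed

text \<open>This gives the value at \<open>None\<close> of a product of forms. Degree bounds replace
  degrees because a form may vanish at \<open>None\<close>.\<close>

lemma coeff_mult_degree_bounds:
  fixes p q :: "'a::comm_semiring_0 poly"
  assumes "degree p \<le> k" "degree q \<le> l"
  shows "coeff (p * q) (k + l) = coeff p k * coeff q l"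
proof -
  have "coeff (p * q) (k + l) = (\<Sum>i\<in>{k}. coeff p i * coeff q (k + l - i))"
    unfolding coeff_mult
  proof (rule sum.mono_neutral_right)
    show "\<forall>i\<in>{..k + l} - {k}. coeff p i * coeff q (k + l - i) = 0"
    proof
      fix i assume "i \<in> {..k + l} - {k}"
      then have "k < i \<or> l < k + l - i" by auto
      then have "coeff p i = 0 \<or> coeff q (k + l - i) = 0"
        using assms by (auto intro!: coeff_eq_0)
      then show "coeff p i * coeff q (k + l - i) = 0" by auto
    qed
  qed auto
  then show ?thesis by simp
qed

lemma direction_form_mult:
  assumes "direction_form k \<phi>" "direction_form l \<psi>"
  shows "direction_form (k + l) (\<lambda>d. \<phi> d * \<psi> d)"
proof -
  obtain p q where "degree p \<le> k" "\<forall>m. \<phi> (Some m) = poly p m" "\<phi> None = coeff p k"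
    "degree q \<le> l" "\<forall>m. \<psi> (Some m) = poly q m" "\<psi> None = coeff q l"
    using assms unfolding direction_form_def by blast
  then show ?thesis
    unfolding direction_form_def
    by (intro exI[of _ "p * q"])
      (auto simp: coeff_mult_degree_bounds intro: order.trans[OF degree_mult_le])
qed

lemma direction_form_uminus: "direction_form k \<phi> \<Longrightarrow> direction_form k (\<lambda>d. - \<phi> d)"
  using direction_form_mult[OF direction_form_const[of "- 1"], of k \<phi>] by simp

lemma direction_form_diff:
  "direction_form k \<phi> \<Longrightarrow> direction_form k \<psi> \<Longrightarrow> direction_form k (\<lambda>d. \<phi> d - \<psi> d)"
  using direction_form_add[OF _ direction_form_uminus, of k \<phi> \<psi>] by simp

lemma direction_form_power:
  assumes "direction_form k \<phi>"
  shows "direction_form (n * k) (\<lambda>d. \<phi> d ^ n)"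
proof (induction n)
  case 0
  show ?case using direction_form_const[of 1] by simp
next
  case (Suc n)
  show ?case using direction_form_mult[OF assms Suc] by simp
qed

lemma direction_form_sum:
  assumes "\<And>i. i \<in> I \<Longrightarrow> direction_form k (\<phi> i)"
  shows "direction_form k (\<lambda>d. \<Sum>i\<in>I. \<phi> i d)"
  using assms
proof (induction I rule: infinite_finite_induct)
  case (insert i I)
  have "direction_form k (\<lambda>d. \<phi> i d + (\<Sum>i\<in>I. \<phi> i d))"
    using insert by (intro direction_form_add) simp_all
  then show ?case using insert.hyps by simp
qed (simp_all add: direction_form_zero)

text \<open>A zero at \<open>None\<close> is paid for by the degree: it makes the coefficient of
  exponent k vanish, which leaves at most k - 1 finite zeros.\<close>

lemma card_zeros_direction_form_le:
  fixes \<phi> :: "'a::{field, finite} option \<Rightarrow> 'a"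
  assumes "direction_form k \<phi>" "\<phi> d0 \<noteq> 0"
  shows "card {d. \<phi> d = 0} \<le> k"
proof -
  obtain p where p: "degree p \<le> k" "\<And>m. \<phi> (Some m) = poly p m" "\<phi> None = coeff p k"
    using assms(1) unfolding direction_form_def by blast
  have "p \<noteq> 0" using assms(2) p by (cases d0) auto
  let ?Z = "{x. poly p x = 0}"
  have Z: "card (Some ` ?Z) \<le> degree p"
    using card_poly_roots_bound[OF \<open>p \<noteq> 0\<close>] by (simp add: card_image)
  show ?thesis
  proof (cases "coeff p k = 0")
    case True
    then have "degree p < k"
      using p(1) \<open>p \<noteq> 0\<close> by (metis le_neq_implies_less leading_coeff_0_iff)
    have "{d. \<phi> d = 0} \<subseteq> insert None (Some ` ?Z)"
    proof
      fix d assume "d \<in> {d. \<phi> d = 0}"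
      then show "d \<in> insert None (Some ` ?Z)" using p(2) by (cases d) auto
    qed
    then have "card {d. \<phi> d = 0} \<le> card (insert None (Some ` ?Z))"
      by (intro card_mono) auto
    also have "\<dots> \<le> Suc (card (Some ` ?Z))" by (simp add: card_insert_if)
    finally show ?thesis using Z \<open>degree p < k\<close> by simp
  next
    case False
    have "{d. \<phi> d = 0} \<subseteq> Some ` ?Z"
    proof
      fix d assume "d \<in> {d. \<phi> d = 0}"
      then show "d \<in> Some ` ?Z" using p False by (cases d) auto
    qed
    then have "card {d. \<phi> d = 0} \<le> card (Some ` ?Z)"
      by (intro card_mono) auto
    then show ?thesis using Z p(1) by simp
  qed
qed

text \<open>This encodes a homogeneous polynomial of degree m in X and the two coordinates of the
  direction.\<close>

definition homogeneous_family :: "nat \<Rightarrow> ('a::field option \<Rightarrow> 'a poly) \<Rightarrow> bool" where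
  "homogeneous_family m P \<longleftrightarrow>
     (\<forall>d. degree (P d) \<le> m) \<and> (\<forall>k\<le>m. direction_form (m - k) (\<lambda>d. coeff (P d) k))"

lemma homogeneous_family_one: "homogeneous_family 0 (\<lambda>_. 1)"
  by (simp add: homogeneous_family_def direction_form_const)

lemma homogeneous_family_mult:
  assumes P: "homogeneous_family m P" and Q: "homogeneous_family n Q"
  shows "homogeneous_family (m + n) (\<lambda>d. P d * Q d)"
  unfolding homogeneous_family_def
proof (intro conjI allI impI)
  fix d
  show "degree (P d * Q d) \<le> m + n"
    using P Q unfolding homogeneous_family_def
    by (meson add_mono degree_mult_le order.trans)
next
  fix k assume "k \<le> m + n"
  show "direction_form (m + n - k) (\<lambda>d. coeff (P d * Q d) k)"
    unfolding coeff_mult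
  proof (rule direction_form_sum)
    fix i assume "i \<in> {..k}"
    show "direction_form (m + n - k) (\<lambda>d. coeff (P d) i * coeff (Q d) (k - i))"
    proof (cases "i \<le> m \<and> k - i \<le> n")
      case True
      then have "direction_form ((m - i) + (n - (k - i))) (\<lambda>d. coeff (P d) i * coeff (Q d) (k - i))"
        using P Q unfolding homogeneous_family_def by (intro direction_form_mult) auto
      moreover have "(m - i) + (n - (k - i)) = m + n - k"
        using True \<open>i \<in> {..k}\<close> by auto
      ultimately show ?thesis by simp
    next
      case False
      then have "coeff (P d) i * coeff (Q d) (k - i) = 0" for d
        using P Q unfolding homogeneous_family_def
        by (metis coeff_eq_0 le_less_trans linorder_not_less mult_eq_0_iff)
      then show ?thesis by (simp only: direction_form_zero)
    qed
  qed
qed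

text \<open>Substituting a linear form for X gives each term the degree
  \<open>(m - k) + k\<close>.\<close>

lemma homogeneous_family_poly:
  assumes P: "homogeneous_family m P" and \<phi>: "direction_form 1 \<phi>"
  shows "direction_form m (\<lambda>d. poly (P d) (\<phi> d))"
proof -
  have eq: "poly (P d) (\<phi> d) = (\<Sum>k\<le>m. coeff (P d) k * \<phi> d ^ k)" for d
    unfolding poly_altdef using P
    by (intro sum.mono_neutral_left) (auto simp: homogeneous_family_def coeff_eq_0)
  have "direction_form m (\<lambda>d. coeff (P d) k * \<phi> d ^ k)" if "k \<le> m" for k
  proof -
    have "direction_form ((m - k) + k * 1) (\<lambda>d. coeff (P d) k * \<phi> d ^ k)"
      using P \<phi> that unfolding homogeneous_family_def
      by (intro direction_form_mult direction_form_power) auto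
    then show ?thesis using that by simp
  qed
  then show ?thesis unfolding eq by (intro direction_form_sum) auto
qed

text \<open>The coefficients of a quotient of \<open>X ^ q\<close> by a monic family satisfy a homogeneous recurrence.\<close>

lemma homogeneous_family_monom_div:
  fixes P :: "'a::field option \<Rightarrow> 'a poly"
  assumes P: "homogeneous_family n P" and monic: "\<And>d. coeff (P d) n = 1"
    and n: "0 < n" "n \<le> q"
  shows "homogeneous_family (q - n) (\<lambda>d. monom 1 q div P d)"
proof -
  let ?F = "\<lambda>d. monom 1 q div P d" and ?\<epsilon> = "q - n"
  have degP: "degree (P d) = n" for d
    using P monic[of d] unfolding homogeneous_family_def
    by (metis le_antisym le_degree zero_neq_one)
  have P0: "P d \<noteq> 0" for d using degP[of d] n by auto
  \<comment> \<open>The remainder has degree below n, so from exponent n on the product has the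
    coefficients of X^q.\<close>
  have top: "coeff (P d * ?F d) k = (if k = q then 1 else 0)" if "n \<le> k" for d k
  proof -
    have "P d * ?F d = monom 1 q - monom 1 q mod P d"
      by (simp add: minus_mod_eq_mult_div)
    moreover have "coeff (monom 1 q mod P d) k = 0"
      using degree_mod_less'[of "P d" "monom 1 q"] P0[of d] degP[of d] that
      by (cases "monom 1 q mod P d = 0") (auto intro: coeff_eq_0)
    ultimately show ?thesis by simp
  qed
  have degF: "degree (?F d) \<le> ?\<epsilon>" for d
  proof (cases "?F d = 0")
    case False
    then have "degree (P d * ?F d) = n + degree (?F d)" "P d * ?F d \<noteq> 0"
      using P0[of d] degP[of d] by (simp_all add: degree_mult_eq)
    then have "coeff (P d * ?F d) (n + degree (?F d)) \<noteq> 0"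
      by (metis leading_coeff_0_iff)
    then have "n + degree (?F d) = q"
      using top[of "n + degree (?F d)" d] by (auto split: if_splits)
    then show ?thesis by simp
  qed simp
  \<comment> \<open>Compare coefficients at \<open>n + k\<close>; monicity isolates one coefficient
    of the quotient in terms of higher ones.\<close>
  have rec: "coeff (?F d) k =
      (if k = ?\<epsilon> then 1 else 0) - (\<Sum>i<n. coeff (P d) i * coeff (?F d) (n + k - i))"
    if "k \<le> ?\<epsilon>" for d k
  proof -
    have "coeff (P d * ?F d) (n + k) = (\<Sum>i\<le>n + k. coeff (P d) i * coeff (?F d) (n + k - i))"
      by (rule coeff_mult)
    also have "\<dots> = (\<Sum>i\<in>insert n {..<n}. coeff (P d) i * coeff (?F d) (n + k - i))"
      using degP[of d] by (intro sum.mono_neutral_right) (auto simp: coeff_eq_0)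
    also have "\<dots> = coeff (?F d) k + (\<Sum>i<n. coeff (P d) i * coeff (?F d) (n + k - i))"
      by (simp add: monic)
    finally show ?thesis
      using top[of "n + k" d] that n by (auto simp: algebra_simps)
  qed
  \<comment> \<open>Induction on the distance j from the top exponent \<open>q - n\<close>.\<close>
  have "direction_form j (\<lambda>d. coeff (?F d) (?\<epsilon> - j))" if "j \<le> ?\<epsilon>" for j
    using that
  proof (induction j rule: less_induct)
    case (less j)
    have "direction_form j (\<lambda>d. coeff (P d) i * coeff (?F d) (n + (?\<epsilon> - j) - i))" if "i < n" for i
    proof (cases "n - i \<le> j")
      case True
      let ?j = "j - (n - i)"
      have idx: "n + (?\<epsilon> - j) - i = ?\<epsilon> - ?j"
        using True that less.prems by simp
      have "direction_form ((n - i) + ?j) (\<lambda>d. coeff (P d) i * coeff (?F d) (?\<epsilon> - ?j))"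
        using P that less True unfolding homogeneous_family_def
        by (intro direction_form_mult less.IH) auto
      then show ?thesis unfolding idx using True by simp
    next
      \<comment> \<open>Here the index exceeds \<open>q - n\<close>, beyond the degree of the
        quotient.\<close>
      case False
      then have "coeff (?F d) (n + (?\<epsilon> - j) - i) = 0" for d
        using degF[of d] less.prems by (intro coeff_eq_0) linarith
      then show ?thesis by (simp add: direction_form_zero)
    qed
    moreover have "direction_form j (\<lambda>_. if ?\<epsilon> - j = ?\<epsilon> then 1 else (0 :: 'a))"
      using less.prems by (cases "j = 0") (auto simp: direction_form_const direction_form_zero)
    ultimately have "direction_form j (\<lambda>d. (if ?\<epsilon> - j = ?\<epsilon> then 1 else 0) -
        (\<Sum>i<n. coeff (P d) i * coeff (?F d) (n + (?\<epsilon> - j) - i)))"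
      by (intro direction_form_diff direction_form_sum) auto
    then show ?case
      by (subst rec) simp_all
  qed
  then have "direction_form (?\<epsilon> - k) (\<lambda>d. coeff (?F d) (?\<epsilon> - (?\<epsilon> - k)))" for k
    by simp
  then show ?thesis
    unfolding homogeneous_family_def using degF by (metis diff_diff_cancel)
qed

section \<open>Directions and intercepts\<close>

text \<open>The values are those of the linear form v * \<open>snd P\<close> - u *
  \<open>fst P\<close> at (u, v) = (m, 1) and (1, 0), which explains the sign at
  \<open>None\<close>.\<close>

primrec intercept :: "'a::field option \<Rightarrow> 'a \<times> 'a \<Rightarrow> 'a" where
  "intercept None P = - fst P"
| "intercept (Some m) P = snd P - m * fst P"

lemma intercept_eq_iff:
  assumes "P \<noteq> Q"
  shows "intercept d P = intercept d Q \<longleftrightarrow> direction P Q = d"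
proof (cases d)
  case None
  then show ?thesis by (auto simp: direction_def)
next
  case (Some m)
  have "snd P - m * fst P = snd Q - m * fst Q \<longleftrightarrow> snd Q - snd P = m * (fst Q - fst P)"
    by (auto simp: algebra_simps)
  then show ?thesis
    using Some assms by (auto simp: direction_def nonzero_divide_eq_eq prod_eq_iff)
qed

lemma direction_form_intercept: "direction_form 1 (\<lambda>d. intercept d P)"
  unfolding direction_form_def by (rule exI[of _ "[:snd P, - fst P:]"]) auto

lemma affine_line_intercept: "affine_line {P. intercept d P = c}"
proof (cases d)
  case None
  then have "{P. intercept d P = c} = {(x, y). (- 1) * x + 0 * y = c}" by auto
  then show ?thesis unfolding affine_line_def
    by (intro exI[of _ "- 1"] exI[of _ 0] exI[of _ c]) simp
next
  case (Some m)
  then have "{P. intercept d P = c} = {(x, y). (- m) * x + 1 * y = c}" by auto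
  then show ?thesis unfolding affine_line_def
    by (intro exI[of _ "- m"] exI[of _ 1] exI[of _ c]) simp
qed

lemma directions_singleton_imp_line:
  assumes "directions A = {d}"
  shows "\<exists>L. affine_line L \<and> A \<subseteq> L"
proof -
  obtain P where "P \<in> A" using assms unfolding directions_def by blast
  have "intercept d Q = intercept d P" if "Q \<in> A" for Q
  proof (cases "Q = P")
    case False
    then have "direction Q P \<in> directions A"
      using that \<open>P \<in> A\<close> unfolding directions_def by blast
    then show ?thesis using assms intercept_eq_iff[OF False] by auto
  qed simp
  then have "A \<subseteq> {Q. intercept d Q = intercept d P}" by auto
  then show ?thesis using affine_line_intercept by blast
qed


section \<open>The Redei polynomial and its complement\<close>

locale small_point_set =
  fixes A :: "('a::finite_field \<times> 'a) set" and e q :: nat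
  assumes card_gt_1: "1 < card A"
    and card_le: "card A \<le> q"
    and card_UNIV: "card (UNIV :: 'a set) = q"
    and card_field: "q = CHAR('a) ^ e"
begin

abbreviation "n \<equiv> card A"
abbreviation "D \<equiv> directions A"

text \<open>\<open>redei d\<close>, \<open>complement d\<close> and \<open>completion d\<close> are
  the \<open>R\<^sub>d\<close>, \<open>F\<^sub>d\<close> and \<open>H\<^sub>d\<close> of the
  overview.\<close>

definition redei :: "'a option \<Rightarrow> 'a poly" where
  "redei d = (\<Prod>P\<in>A. [:- intercept d P, 1:])"

definition complement :: "'a option \<Rightarrow> 'a poly" where
  "complement d = monom 1 q div redei d"

definition completion :: "'a option \<Rightarrow> 'a poly" where
  "completion d = redei d * complement d"

lemma direction_in_D: "P \<in> A \<Longrightarrow> Q \<in> A \<Longrightarrow> P \<noteq> Q \<Longrightarrow> direction P Q \<in> D"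
  unfolding directions_def by blast

lemma D_cases:
  assumes "d \<in> D"
  obtains P Q where "P \<in> A" "Q \<in> A" "P \<noteq> Q" "intercept d P = intercept d Q"
  using assms intercept_eq_iff unfolding directions_def by blast

lemma power_q: "x ^ q = x" for x :: 'a
  using finite_field_power_card_eq_same[of x] card_UNIV by simp

lemma card_UNIV_option: "card (UNIV :: 'a option set) = q + 1"
  by (simp add: UNIV_option_conv card_image card_UNIV)

lemma card_D_plus: "card D + card (- D) = q + 1"
proof -
  have "card D + card (- D) = card (UNIV :: 'a option set)"
    by (metis card_Un_disjoint Compl_partition finite_class.finite Compl_disjoint)
  then show ?thesis by (simp add: card_UNIV_option)
qed

lemma redei_nonzero: "redei d \<noteq> 0"
  by (simp add: redei_def)

lemma degree_redei: "degree (redei d) = n"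
  unfolding redei_def by (subst degree_prod_eq_sum_degree) auto

lemma coeff_redei_card: "coeff (redei d) n = 1"
  using lead_coeff_prod[of "\<lambda>P. [:- intercept d P, 1:]" A] degree_redei[of d]
  by (simp add: redei_def)

lemma order_redei: "order r (redei d) = card {P \<in> A. intercept d P = r}"
  unfolding redei_def by (rule order_prod_linear) simp

lemma homogeneous_redei: "homogeneous_family n redei"
proof -
  have "homogeneous_family (card S) (\<lambda>d. \<Prod>P\<in>S. [:- intercept d P, 1:])"
    if "finite S" for S :: "('a \<times> 'a) set"
    using that
  proof (induction S)
    case empty
    then show ?case by (simp add: homogeneous_family_one)
  next
    case (insert P S)
    have lin: "homogeneous_family 1 (\<lambda>d. [:- intercept d P, 1:])"
      unfolding homogeneous_family_def
      by (auto simp: le_Suc_eq direction_form_const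
          intro: direction_form_uminus[OF direction_form_intercept, simplified])
    then show ?case
      using homogeneous_family_mult[OF lin insert.IH] insert.hyps
      by (simp del: mult_pCons_left)
  qed
  then show ?thesis unfolding redei_def[abs_def] by simp
qed

lemma homogeneous_complement: "homogeneous_family (q - n) complement"
  unfolding complement_def[abs_def] using card_gt_1 card_le
  by (intro homogeneous_family_monom_div homogeneous_redei coeff_redei_card) auto

lemma homogeneous_completion: "homogeneous_family q completion"
  using homogeneous_family_mult[OF homogeneous_redei homogeneous_complement] card_le
  unfolding completion_def[abs_def] by simp

lemma completion_eq: "completion d = monom 1 q - monom 1 q mod redei d"
  by (simp add: completion_def complement_def minus_mod_eq_mult_div)

lemma coeff_completion_card: "coeff (completion d) q = 1"
proof -
  have "coeff (monom 1 q mod redei d) q = 0"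
    using degree_mod_less'[of "redei d" "monom 1 q"] redei_nonzero[of d] degree_redei[of d] card_le
    by (cases "monom 1 q mod redei d = 0") (auto intro: coeff_eq_0)
  then show ?thesis by (simp add: completion_eq)
qed

lemma completion_nonzero: "completion d \<noteq> 0"
  using coeff_completion_card[of d] by auto

lemma degree_completion: "degree (completion d) = q"
proof (rule antisym)
  show "degree (completion d) \<le> q"
    using homogeneous_completion by (simp add: homogeneous_family_def)
  show "q \<le> degree (completion d)"
    by (rule le_degree) (simp add: coeff_completion_card)
qed

lemma complement_nonzero: "complement d \<noteq> 0"
  using completion_nonzero[of d] by (auto simp: completion_def)

lemma order_completion:
  "order r (completion d) = order r (redei d) + order r (complement d)"
  unfolding completion_def
  by (rule order_mult) (simp add: redei_nonzero complement_nonzero)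

section \<open>Completions outside \<open>D\<close> and vanishing coefficients\<close>

lemma q_gt_1: "1 < q"
  using card_gt_1 card_le by simp

lemma order_artin_schreier: "order r (monom 1 q - monom 1 1 :: 'a poly) = 1"
  unfolding prod_UNIV_linear[where 'a = 'a, unfolded card_UNIV, symmetric]
  by (subst order_prod_linear) auto

text \<open>Intercepts in such a direction are distinct, so \<open>redei d\<close> divides X^q - X.
  Hence X^q and X have the same remainder, which is X itself because n > 1.\<close>

lemma completion_not_in_D:
  assumes "d \<notin> D"
  shows "completion d = monom 1 q - monom 1 1"
proof -
  have inj: "inj_on (intercept d) A"
  proof (rule inj_onI, rule ccontr)
    fix P Q assume "P \<in> A" "Q \<in> A" "intercept d P = intercept d Q" "P \<noteq> Q"
    then show False using assms intercept_eq_iff[of P Q d] direction_in_D by blast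
  qed
  have "redei d = (\<Prod>r\<in>intercept d ` A. [:- r, 1:])"
    unfolding redei_def by (subst prod.reindex[OF inj]) simp
  then have "redei d dvd (\<Prod>r\<in>UNIV. [:- r, 1:])"
    by (simp add: prod_dvd_prod_subset)
  then have "(monom 1 q - monom 1 1) mod redei d = 0"
    unfolding prod_UNIV_linear card_UNIV by simp
  then have "monom 1 q mod redei d = monom 1 1 mod redei d"
    by (metis mod_eq_dvd_iff mod_0_imp_dvd)
  also have "\<dots> = monom 1 1"
    using card_gt_1 by (intro mod_poly_less) (simp add: degree_redei degree_monom_eq)
  finally show ?thesis by (simp add: completion_eq)
qed

text \<open>The coefficient is a form of degree q - k that vanishes at the q + 1 - |D| directions
  outside \<open>D\<close>, where X^q - X has no term of exponent k. This is more than q - k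
  zeros.\<close>

lemma coeff_completion_eq_0:
  assumes "2 \<le> card D" "card D \<le> k" "k < q"
  shows "coeff (completion d) k = 0"
proof (rule ccontr)
  assume "coeff (completion d) k \<noteq> 0"
  moreover have "direction_form (q - k) (\<lambda>d. coeff (completion d) k)"
    using homogeneous_completion assms unfolding homogeneous_family_def by simp
  ultimately have "card {d. coeff (completion d) k = 0} \<le> q - k"
    by (intro card_zeros_direction_form_le)
  moreover have "- D \<subseteq> {d. coeff (completion d) k = 0}"
    using completion_not_in_D assms by auto
  then have "card (- D) \<le> card {d. coeff (completion d) k = 0}"
    by (intro card_mono) auto
  ultimately show False using card_D_plus assms by linarith
qed

section \<open>Lower bound by multiplicities of roots\<close>

lemma root_redei: "P \<in> A \<Longrightarrow> poly (redei d) (intercept d P) = 0"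
  unfolding redei_def poly_prod by (rule prod_zero) auto

lemma root_completion: "P \<in> A \<Longrightarrow> poly (completion d) (intercept d P) = 0"
  by (simp add: completion_def root_redei)

text \<open>
  Writing \<open>completion d = X ^ q + g\<close>, the distinct roots of the Redei polynomial are roots of
  \<open>X + g\<close>, because \<open>z ^ q = z\<close>; their surplus multiplicity is controlled by the derivative of \<open>K\<close>.
\<close>

lemma card_le_of_pderiv_nonzero:
  assumes d: "d \<in> D" and D: "2 \<le> card D"
    and K: "completion d = K ^ (CHAR('a) ^ l)" "pderiv K \<noteq> 0" and l: "l < e"
  shows "n + 2 * CHAR('a) ^ l + 1 \<le> (CHAR('a) ^ l + 1) * card D"
proof -
  let ?t = "CHAR('a) ^ l" and ?Z = "intercept d ` A"
  define h where "h = completion d - monom 1 q + monom 1 1"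
  have t: "0 < ?t" by simp
  \<comment> \<open>Otherwise all roots of the completion are simple, while a determined direction
    has a line through two points of \<open>A\<close>, hence a multiple root.\<close>
  have "h \<noteq> 0"
  proof
    assume "h = 0"
    then have "completion d = monom 1 q - monom 1 1"
      by (simp add: h_def algebra_simps eq_neg_iff_add_eq_0)
    then have "order r (redei d) \<le> 1" for r
      using order_artin_schreier[of r] order_completion[of r d] by simp
    moreover obtain P Q where PQ: "P \<in> A" "Q \<in> A" "P \<noteq> Q" "intercept d P = intercept d Q"
      using d by (rule D_cases)
    then have "card {P, Q} \<le> order (intercept d P) (redei d)"
      unfolding order_redei by (intro card_mono) auto
    ultimately show False using PQ by (metis card_2_iff not_less_eq_eq numeral_2_eq_2 One_nat_def)
  qed
  have "degree h \<le> card D - 1"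
  proof (rule degree_le, intro allI impI)
    fix k assume "card D - 1 < k"
    then have k: "card D \<le> k" "k \<noteq> 1" using D by auto
    have "coeff (completion d) k = (if k = q then 1 else 0)"
      using coeff_completion_eq_0[OF D k(1), of d] coeff_completion_card[of d]
        degree_completion[of d] coeff_eq_0[of "completion d" k]
      by (metis linorder_neqE_nat)
    then show "coeff h k = 0" using k(2) by (simp add: h_def)
  qed
  moreover have "?Z \<subseteq> {z. poly h z = 0}"
    by (auto simp: h_def root_completion poly_monom power_q)
  then have "card ?Z \<le> card {z. poly h z = 0}"
    by (intro card_mono) auto
  ultimately have Z: "card ?Z \<le> card D - 1"
    using card_poly_roots_bound[OF \<open>h \<noteq> 0\<close>] by linarith
  \<comment> \<open>The top exponent \<open>?j\<close> of K that survives differentiation is prime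
    to the characteristic. In the completion it moves to \<open>?t * ?j\<close>, which is below |D|
    or equal to q; equality would make \<open>?j\<close> a nontrivial power of the characteristic,
    as l < e.\<close>
  have K': "?t * (degree (pderiv K) + 1) \<le> card D - 1"
  proof (rule ccontr)
    let ?j = "degree (pderiv K) + 1"
    assume "\<not> ?thesis"
    then have big: "card D \<le> ?t * ?j" using D by linarith
    have "of_nat ?j * coeff K ?j \<noteq> 0"
      using K(2) leading_coeff_0_iff[of "pderiv K"] by (simp add: coeff_pderiv)
    then have nz: "of_nat ?j \<noteq> (0 :: 'a)" "coeff K ?j \<noteq> 0" by auto
    have "coeff (completion d) (?t * ?j) \<noteq> 0"
      unfolding K(1) coeff_power_CHAR_power using nz(2) by simp
    then have "?t * ?j = q"
      using coeff_completion_eq_0[OF D big, of d] degree_completion[of d]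
      by (metis le_degree le_neq_implies_less)
    also have "q = ?t * CHAR('a) ^ (e - l)"
      using l by (simp add: card_field power_add [symmetric])
    finally have "?j = CHAR('a) ^ (e - l)" using t by (simp only: nat_mult_eq_cancel1)
    then have "CHAR('a) dvd ?j" using l by (simp add: dvd_power)
    then show False using nz(1) of_nat_eq_0_iff_char_dvd by blast
  qed
  have "K \<noteq> 0" using K(2) by auto
  have "n = (\<Sum>z\<in>?Z. order z (redei d))"
    using sum.image_gen[of A "\<lambda>_. 1 :: nat" "intercept d"] by (simp add: order_redei)
  also have "\<dots> \<le> (\<Sum>z\<in>?Z. ?t * (1 + order z (pderiv K)))"
  proof (rule sum_mono)
    fix z
    have "order z (redei d) \<le> ?t * order z K"
      using order_completion[of z d] order_power[OF \<open>K \<noteq> 0\<close>, of z ?t] K(1) by simp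
    also have "\<dots> \<le> ?t * (1 + order z (pderiv K))"
      using order_le_Suc_order_pderiv[OF K(2)] by (intro mult_left_mono) auto
    finally show "order z (redei d) \<le> ?t * (1 + order z (pderiv K))" .
  qed
  also have "\<dots> = ?t * (card ?Z + (\<Sum>z\<in>?Z. order z (pderiv K)))"
    by (simp add: sum.distrib distrib_left sum_distrib_left)
  also have "\<dots> \<le> ?t * (card D - 1 + degree (pderiv K))"
    using Z sum_order_le_degree'[OF K(2)] by (intro mult_left_mono add_mono) auto
  \<comment> \<open>The extra \<open>?t\<close> on the left comes from the + 1 in
    \<open>K'\<close>.\<close>
  finally have "n + ?t \<le> ?t * (card D - 1) + (card D - 1)"
    using K' by (simp add: algebra_simps)
  moreover obtain c where "card D = c + 2" using D by (metis add.commute le_Suc_ex)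
  ultimately show ?thesis by (simp add: algebra_simps)
qed

section \<open>Upper bound by the pencil of lines through a point\<close>

text \<open>The completion X^q - X has only simple roots, and \<open>redei d\<close> already uses up
  this one. So the value of the complement along the pencil at P is not the zero form.\<close>

lemma complement_root_not_in_D:
  assumes "P \<in> A" "d \<notin> D"
  shows "poly (complement d) (intercept d P) \<noteq> 0"
proof -
  let ?r = "intercept d P"
  have "order ?r (redei d) \<noteq> 0"
    using root_redei[OF assms(1)] redei_nonzero order_root by blast
  moreover have "order ?r (redei d) + order ?r (complement d) = 1"
    using order_completion[of ?r d] order_artin_schreier[of ?r] completion_not_in_D[OF assms(2)]
    by simp
  ultimately have "order ?r (complement d) = 0" by simp
  then show ?thesis using complement_nonzero order_root by blast
qed

text \<open>
  Each line through \<open>P\<close> in a determined direction carries a multiple of \<open>t\<close> points, when roots of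
  the complement are counted too; only \<open>q - n\<close> of these lines can pass through such a root.
\<close>

lemma pencil_count:
  assumes D: "D \<noteq> UNIV" "q - n \<le> card D"
    and pow: "\<And>d. d \<in> D \<Longrightarrow> \<exists>K. completion d = K ^ t"
  shows "(card D - (q - n)) * (t - 1) + (q - n) * (t - 1 - (q - n)) \<le> n - 1"
proof -
  let ?\<epsilon> = "q - n"
  have "A \<noteq> {}" using card_gt_1 by auto
  then obtain P where P: "P \<in> A" by blast
  define c where "c d = card {Q \<in> A - {P}. direction P Q = d}" for d
  \<comment> \<open>\<open>B\<close> collects the exceptional lines, on which a root of the
    complement can replace points of \<open>A\<close>.\<close>
  define B where "B = {d \<in> D. poly (complement d) (intercept d P) = 0}"
  obtain d0 where "d0 \<notin> D" using D(1) by blast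
  have "card B \<le> card {d. poly (complement d) (intercept d P) = 0}"
    by (rule card_mono) (auto simp: B_def)
  also have "\<dots> \<le> ?\<epsilon>"
    using complement_root_not_in_D[OF P \<open>d0 \<notin> D\<close>]
      homogeneous_family_poly[OF homogeneous_complement direction_form_intercept]
    by (intro card_zeros_direction_form_le)
  finally have B: "card B \<le> ?\<epsilon>" .
  have step: "t - 1 - order (intercept d P) (complement d) \<le> c d" if "d \<in> D" for d
  proof -
    let ?r = "intercept d P"
    obtain K where K: "completion d = K ^ t" using pow[OF \<open>d \<in> D\<close>] by blast
    have "K \<noteq> 0 \<or> t = 0" using K completion_nonzero[of d] by (auto simp: power_0_left)
    then have "t dvd order ?r (completion d)" using K by (auto simp: order_power)
    moreover have "order ?r (completion d) \<noteq> 0"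
      using root_completion[OF P] completion_nonzero order_root by blast
    \<comment> \<open>A positive multiple of t is at least t.\<close>
    ultimately have "t \<le> order ?r (redei d) + order ?r (complement d)"
      unfolding order_completion[symmetric] by (simp add: dvd_imp_le)
    \<comment> \<open>P itself accounts for the difference of one between the order and
      \<open>c d\<close>.\<close>
    moreover have "{Q \<in> A. intercept d Q = ?r} = insert P {Q \<in> A - {P}. direction P Q = d}"
      using P intercept_eq_iff[of P] by (auto dest: sym)
    then have "order ?r (redei d) = c d + 1"
      by (simp add: order_redei c_def)
    ultimately show ?thesis by simp
  qed
  have "(\<Sum>d\<in>D - B. t - 1) + (\<Sum>d\<in>B. t - 1 - ?\<epsilon>) \<le> (\<Sum>d\<in>D - B. c d) + (\<Sum>d\<in>B. c d)"
  proof (intro add_mono sum_mono)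
    fix d assume "d \<in> D - B"
    then show "t - 1 \<le> c d" using step[of d] by (auto simp: B_def order_0I)
  next
    fix d assume "d \<in> B"
    have "order (intercept d P) (complement d) \<le> ?\<epsilon>"
      using order_degree[OF complement_nonzero] homogeneous_complement
      unfolding homogeneous_family_def by (meson le_trans)
    then show "t - 1 - ?\<epsilon> \<le> c d" using step[of d] \<open>d \<in> B\<close> by (simp add: B_def)
  qed
  also have "\<dots> = (\<Sum>d\<in>D. c d)"
    using sum.subset_diff[of B D c] by (simp add: B_def)
  also have "\<dots> = n - 1"
  proof -
    have "direction P ` (A - {P}) \<subseteq> D" using direction_in_D[OF P] by blast
    then show ?thesis
      using sum.group[of "A - {P}" D "direction P" "\<lambda>_. 1 :: nat"] P by (simp add: c_def)
  qed
  finally have "(card D - card B) * (t - 1) + card B * (t - 1 - ?\<epsilon>) \<le> n - 1"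
    by (simp add: card_Diff_subset B_def)
  \<comment> \<open>Replacing |B| by its upper bound q - n only lowers the left side, since an
    exceptional line contributes the smaller term.\<close>
  moreover have "(card D - ?\<epsilon>) * (t - 1) + ?\<epsilon> * (t - 1 - ?\<epsilon>)
      \<le> (card D - card B) * (t - 1) + card B * (t - 1 - ?\<epsilon>)"
  proof -
    obtain b where b: "?\<epsilon> = card B + b" using B le_Suc_ex by blast
    obtain c where c: "card D = ?\<epsilon> + c" using D(2) le_Suc_ex by blast
    have "b * (t - 1 - ?\<epsilon>) \<le> b * (t - 1)" by (rule mult_left_mono) simp_all
    moreover have "card D - ?\<epsilon> = c" "card D - card B = c + b" using b c by simp_all
    ultimately show ?thesis by (simp add: b add_mult_distrib)
  qed
  ultimately show ?thesis by linarith
qed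

section \<open>Choice of the exponent\<close>

text \<open>By degrees K would be linear; its single root would put all of \<open>A\<close> on one
  line of direction d.\<close>

lemma completion_not_power_card:
  assumes d: "d \<in> D" and D: "2 \<le> card D"
  shows "completion d \<noteq> K ^ q"
proof
  assume K: "completion d = K ^ q"
  have "K \<noteq> 0" using K completion_nonzero[of d] q_gt_1 by auto
  have "q * degree K = q * 1"
    using degree_completion[of d] degree_power_eq[OF \<open>K \<noteq> 0\<close>, of q] K by simp
  then have "degree K = 1" using q_gt_1 by (metis mult_cancel1 not_one_less_zero)
  then have roots: "card {z. poly K z = 0} \<le> 1"
    using card_poly_roots_bound[OF \<open>K \<noteq> 0\<close>] by simp
  have "D \<subseteq> {d}"
  proof
    fix d' assume "d' \<in> D"
    then obtain P Q where PQ: "P \<in> A" "Q \<in> A" "P \<noteq> Q" "d' = direction P Q"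
      unfolding directions_def by blast
    then have "poly K (intercept d P) = 0" "poly K (intercept d Q) = 0"
      using root_completion[of _ d] K by (auto simp: poly_power)
    then have "intercept d P = intercept d Q"
      using roots by (auto simp: card_le_Suc0_iff_eq)
    then show "d' \<in> {d}" using PQ intercept_eq_iff[of P Q d] by simp
  qed
  then have "card D \<le> card {d}" by (intro card_mono) auto
  then show False using D by simp
qed

text \<open>The greatest common exponent serves both bounds: all completions are powers, and by
  maximality some K is not a further power, so its derivative is nonzero.\<close>

lemma exists_exponent:
  assumes D: "2 \<le> card D"
  obtains l d K where "l < e" "\<And>d. d \<in> D \<Longrightarrow> \<exists>K. completion d = K ^ (CHAR('a) ^ l)"
    "d \<in> D" "completion d = K ^ (CHAR('a) ^ l)" "pderiv K \<noteq> 0"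
proof -
  define good where "good l \<longleftrightarrow> (\<forall>d\<in>D. \<exists>K. completion d = K ^ (CHAR('a) ^ l))" for l
  have "D \<noteq> {}" using D by auto
  then obtain d1 where d1: "d1 \<in> D" by blast
  have bound: "l \<le> e" if good: "good l" for l
  proof -
    obtain K where "completion d1 = K ^ (CHAR('a) ^ l)"
      using good d1 unfolding good_def by blast
    moreover from this have "K \<noteq> 0" using completion_nonzero[of d1] by auto
    ultimately have "CHAR('a) ^ l dvd q"
      using degree_completion[of d1] degree_power_eq[of K "CHAR('a) ^ l"] by (metis dvd_triv_left)
    then show "l \<le> e"
      unfolding card_field using prime_gt_1_nat[OF CHAR_prime[where 'a = 'a]]
      by (rule power_dvd_imp_le)
  qed
  define l where "l = (GREATEST l. good l)"
  have "good 0" by (simp add: good_def)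
  then have l: "good l" and max: "\<not> good (Suc l)"
    using GreatestI_nat[of good 0 e] Greatest_le_nat[of good "Suc l" e] bound
    unfolding l_def by (auto simp: not_less_eq_eq)
  have "l \<noteq> e"
    using l completion_not_power_card[OF d1 D] d1 unfolding good_def card_field by auto
  then have "l < e" using bound[OF l] by simp
  obtain d where d: "d \<in> D" "\<And>K. completion d \<noteq> K ^ (CHAR('a) ^ Suc l)"
    using max unfolding good_def by blast
  obtain K where K: "completion d = K ^ (CHAR('a) ^ l)"
    using l d(1) unfolding good_def by blast
  have "pderiv K \<noteq> 0"
  proof
    assume "pderiv K = 0"
    then obtain r where "K = r ^ CHAR('a)"
      using pderiv_eq_0_imp_CHAR_power[of K e] card_field card_UNIV by auto
    then have "completion d = r ^ (CHAR('a) ^ Suc l)"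
      using K by (simp add: power_mult [symmetric])
    then show False using d(2) by blast
  qed
  then show thesis
    using that[OF \<open>l < e\<close> _ d(1) K] l unfolding good_def by blast
qed

end

section \<open>Case distinction on |D| and passage to real inequalities\<close>

theorem theorem2p2:
  fixes p e q :: nat
    and A :: "('a::finite_field \<times> 'a) set"
  assumes "prime p"
    and "e \<ge> 1"
    and "q = p ^ e"
    and "card (UNIV :: 'a set) = q"
    and "1 < card A"
    and "card A \<le> q"
  shows "(card (directions A) = 1 \<and> (\<exists>L. affine_line L \<and> A \<subseteq> L))
    \<or> (card (directions A) = q + 1 \<and> directions A = UNIV)
    \<or> (\<exists>l1 l2 :: nat. 0 \<le> l2 \<and> l2 \<le> l1 \<and> l1 < e
        \<and> real (card (directions A)) \<ge> (real (card A) - 1) / (real p ^ l2 + 1) + 2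
        \<and> (l1 \<noteq> 0 \<longrightarrow>
             real (card (directions A)) \<le> real q - real (card A)
               + max 1 ((real (card A) - 1
                          - (real q - real (card A))
                            * max 0 (real (card A) + real p ^ l1 - real q - 1))
                        / (real p ^ l1 - 1))))"
proof -
  have char: "CHAR('a) = p"
    using CHAR_dvd_card_UNIV[where 'a = 'a] assms(1,3,4) CHAR_prime[where 'a = 'a]
    by (metis prime_dvd_power primes_dvd_imp_eq)
  interpret small_point_set A e q
    by unfold_locales (use assms char in auto)
  let ?D = "directions A" and ?n = "card A"
  obtain P Q where PQ: "P \<in> A" "Q \<in> A" "P \<noteq> Q"
    using assms(5) by (metis card_le_Suc0_iff_eq card.infinite finite_class.finite not_less One_nat_def)
  have "card ?D \<noteq> 0" using direction_in_D[OF PQ] by auto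
  then consider "card ?D = 1" | "?D = UNIV" | "2 \<le> card ?D" "?D \<noteq> UNIV" by linarith
  then show ?thesis
  proof cases
    case 1
    then show ?thesis by (metis card_1_singletonE directions_singleton_imp_line)
  next
    case 2
    then show ?thesis by (simp add: card_UNIV_option)
  next
    case 3
    obtain l d K where l: "l < e" "\<And>d. d \<in> ?D \<Longrightarrow> \<exists>K. completion d = K ^ (p ^ l)"
      and K: "d \<in> ?D" "completion d = K ^ (p ^ l)" "pderiv K \<noteq> 0"
      using exists_exponent[OF 3(1)] unfolding char by blast
    let ?t = "p ^ l"
    have "real (?n + 2 * ?t + 1) \<le> real ((?t + 1) * card ?D)"
      using card_le_of_pderiv_nonzero[OF K(1) 3(1), unfolded char, OF K(2,3) l(1)]
      by (simp only: of_nat_le_iff)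
    then have "real ?n - 1 \<le> (real (card ?D) - 2) * (real p ^ l + 1)"
      by (simp add: algebra_simps)
    moreover have "0 < real p ^ l + 1" by (simp add: add_nonneg_pos)
    ultimately have "(real ?n - 1) / (real p ^ l + 1) \<le> real (card ?D) - 2"
      by (simp only: pos_divide_le_eq)
    then have lower: "(real ?n - 1) / (real p ^ l + 1) + 2 \<le> real (card ?D)" by simp
    have upper: "real (card ?D) \<le> real q - real ?n + max 1 ((real ?n - 1 - (real q - real ?n)
        * max 0 (real ?n + real p ^ l - real q - 1)) / (real p ^ l - 1))" if "l \<noteq> 0"
    \<comment> \<open>A small |D| is covered by the 1 in the maximum; otherwise |D| > q - n, and the
      subtraction in \<open>pencil_count\<close> is exact.\<close>
    proof (cases "card ?D \<le> q - ?n + 1")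
      case True
      then have "real (card ?D) \<le> real q - real ?n + 1" using assms(6) by linarith
      then show ?thesis by (smt (verit) max.cobounded1)
    next
      case False
      have t: "1 < ?t" using that prime_gt_1_nat[OF assms(1)] by (intro one_less_power) auto
      have "real ((card ?D - (q - ?n)) * (?t - 1) + (q - ?n) * (?t - 1 - (q - ?n))) \<le> real (?n - 1)"
        using pencil_count[OF 3(2) _ l(2)] False by (simp only: of_nat_le_iff)
      moreover have "real (card ?D - (q - ?n)) = real (card ?D) - (real q - real ?n)"
        "real (?n - 1) = real ?n - 1" "real (q - ?n) = real q - real ?n"
        using False assms(5,6) by (simp_all add: of_nat_diff)
      moreover have "real (?t - 1) = real p ^ l - 1"
        using t by (simp add: of_nat_diff)
      \<comment> \<open>Truncated subtraction on naturals is the source of the inner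
        \<open>max 0\<close>.\<close>
      moreover have "real (?t - 1 - (q - ?n)) = max 0 (real ?n + real p ^ l - real q - 1)"
      proof -
        have "real (?t - 1 - (q - ?n)) = max 0 (real ?t - 1 - (real q - real ?n))"
          using assms(6) t by (auto simp: max_def of_nat_diff simp del: of_nat_power)
        then show ?thesis by (simp add: algebra_simps)
      qed
      ultimately have "(real (card ?D) - (real q - real ?n)) * (real p ^ l - 1) \<le>
          real ?n - 1 - (real q - real ?n) * max 0 (real ?n + real p ^ l - real q - 1)"
        by (simp only: of_nat_add of_nat_mult)
      moreover have "0 < real p ^ l - 1" using t by (simp flip: of_nat_power)
      ultimately have "real (card ?D) - (real q - real ?n) \<le> (real ?n - 1 - (real q - real ?n)
          * max 0 (real ?n + real p ^ l - real q - 1)) / (real p ^ l - 1)"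
        by (simp add: pos_le_divide_eq)
      then show ?thesis by linarith
    qed
    show ?thesis using lower upper l(1) by blast
  qed
qed

end
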